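(* Let $X,X'$ be sets, $b:X\times X'\to[-\infty,+\infty)$ a kernel, $\mathcal I$ an index set, $(x_m)_{m\in\mathcal I}\in X^{\mathcal I}$ points, $\mathcal L:\overline{\mathbb R}^{\mathcal I}\to\overline{\mathbb R}$ a function, and set $\hat X=\{x_m\}_{m\in\mathcal I}$. If the problem $$(1)\qquad \min_{f\in\mathrm{Rg}(B)}\ \mathcal L\big((f(x_m))_{m\in\mathcal I}\big)$$ has a solution $\bar f\in\mathrm{Rg}_{\partial\text{-}\hat X}(B)$ with finite values $(\bar f(x_m))_{m\in\mathcal I}\in\mathbb R^{\mathcal I}$, then it also has a solution of the form $$f^0(\cdot)=\max_{m\in\mathcal I}\ b(\cdot,p_m)-_\bot b(x_m,p_m)+y_m,\qquad (p_m)_{m\in\mathcal I}\in (X')^{\mathcal I},\ (y_m)_{m\in\mathcal I}\in\mathbb R^{\mathcal I},\quad f^0(x_m)=y_m\ \ \forall m\in\mathcal I,$$ which can be obtained from a solution $(p_m,y_m)_{m\in\mathcal I}$ of $$(2)\qquad \min_{(p_m,y_m)_{m\in\mathcal I}\in(X'\times\mathbb R)^{\mathcal I}}\ \mathcal L\big((y_m)_{m\in\mathcal I}\big)\quad\text{s.t.}\quad y_n-y_m\ge b(x_n,p_m)-_\bot b(x_m,p_m)\ \ \forall n,m\in\mathcal I.$$ Conversely, if (2) has a solution $(p_m,y_m)_{m\in\mathcal I}$, then it is also (through the corresponding function $f^0$) a solution in $\mathrm{Rg}_{\partial\text{-}\hat X}(B)$ of (1).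
   Context: $\overline{\mathbb R}=[-\infty,+\infty]$; $+_\bot$ extends addition to $\overline{\mathbb R}$ with $-\infty$ absorbing, and $a-_\bot c:=a+_\bot(-c)$. For $b:X\times X'\to[-\infty,+\infty)$, the range is $\mathrm{Rg}(B)=\{f\in\overline{\mathbb R}^X:\ f(\cdot)=\sup_{p\in X'} b(\cdot,p)-_\bot w(p)\text{ for some } w\in\overline{\mathbb R}^{X'}\}$. For $f\in\overline{\mathbb R}^X$ and $p\in X'$, $\bar Bf(p)=\sup_{x\in X}b(x,p)-_\bot f(x)$. For $\hat X\subset X$, $$\mathrm{Rg}_{\partial\text{-}\hat X}(B)=\Big\{f\in\mathrm{Rg}(B):\ \forall x\in\hat X,\ \exists p_x\in X',\ f(x)=b(x,p_x)-_\bot\bar Bf(p_x)=\sup_{p\in X'}b(x,p)-_\bot\bar Bf(p)\Big\}.$$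
   Formalization: Problem (2) also requires b(x_m,p_m) > -∞; the max in f^0 is a supremum; in the converse, f^0 solves (1) over Rg(B) if (1) has a solution in Rg_{∂-X̂}(B) with finite values at the x_m, and otherwise is only shown minimal among such functions. *)

theory Defs
  imports "HOL-Library.Extended_Real" "HOL-Library.FuncSet"
begin

text \<open>
  Addition on the extended reals with \<open>-\<infinity>\<close> absorbing.  The library addition on type \<open>ereal\<close>
  makes \<open>+\<infinity>\<close> absorbing instead.
\<close>

definition plus_bot :: "ereal \<Rightarrow> ereal \<Rightarrow> ereal"  (infixl "+\<^sub>\<bottom>" 65)
  where "a +\<^sub>\<bottom> c = (if a = -\<infinity> \<or> c = -\<infinity> then -\<infinity> else a + c)"

definition minus_bot :: "ereal \<Rightarrow> ereal \<Rightarrow> ereal"  (infixl "-\<^sub>\<bottom>" 65)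
  where "a -\<^sub>\<bottom> c = a +\<^sub>\<bottom> (- c)"

text \<open>
  The sets \<open>X\<close>, \<open>X'\<close> and the index set \<open>I\<close> are carriers, possibly empty; a family indexed by a
  carrier is a function that is extensional on it.
\<close>

definition Rg :: "'x set \<Rightarrow> 'p set \<Rightarrow> ('x \<Rightarrow> 'p \<Rightarrow> ereal) \<Rightarrow> ('x \<Rightarrow> ereal) set"
  where "Rg X X' b =
    {f \<in> extensional X. \<exists>w. \<forall>z\<in>X. f z = (SUP p\<in>X'. b z p -\<^sub>\<bottom> w p)}"

definition Bbar :: "'x set \<Rightarrow> ('x \<Rightarrow> 'p \<Rightarrow> ereal) \<Rightarrow> ('x \<Rightarrow> ereal) \<Rightarrow> 'p \<Rightarrow> ereal"
  where "Bbar X b f p = (SUP z\<in>X. b z p -\<^sub>\<bottom> f z)"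

definition Rg_subdiff ::
    "'x set \<Rightarrow> 'p set \<Rightarrow> ('x \<Rightarrow> 'p \<Rightarrow> ereal) \<Rightarrow> 'x set \<Rightarrow> ('x \<Rightarrow> ereal) set"
  where "Rg_subdiff X X' b Xh =
    {f \<in> Rg X X' b. \<forall>z\<in>Xh. \<exists>p\<in>X'.
       f z = b z p -\<^sub>\<bottom> Bbar X b f p \<and>
       f z = (SUP q\<in>X'. b z q -\<^sub>\<bottom> Bbar X b f q)}"

definition samples :: "'i set \<Rightarrow> ('i \<Rightarrow> 'x) \<Rightarrow> ('x \<Rightarrow> ereal) \<Rightarrow> 'i \<Rightarrow> ereal"
  where "samples I x f = (\<lambda>m\<in>I. f (x m))"

definition finite_on_samples :: "'i set \<Rightarrow> ('i \<Rightarrow> 'x) \<Rightarrow> ('x \<Rightarrow> ereal) \<Rightarrow> bool"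
  where "finite_on_samples I x f \<longleftrightarrow> (\<forall>m\<in>I. \<bar>f (x m)\<bar> \<noteq> \<infinity>)"

definition solves_range_problem ::
    "'x set \<Rightarrow> 'p set \<Rightarrow> ('x \<Rightarrow> 'p \<Rightarrow> ereal) \<Rightarrow> 'i set \<Rightarrow> ('i \<Rightarrow> 'x) \<Rightarrow>
     (('i \<Rightarrow> ereal) \<Rightarrow> ereal) \<Rightarrow> ('x \<Rightarrow> ereal) \<Rightarrow> bool"
  where "solves_range_problem X X' b I x L f \<longleftrightarrow>
    is_arg_min (\<lambda>g. L (samples I x g)) (\<lambda>g. g \<in> Rg X X' b) f"

definition slope_constraints ::
    "'p set \<Rightarrow> ('x \<Rightarrow> 'p \<Rightarrow> ereal) \<Rightarrow> 'i set \<Rightarrow> ('i \<Rightarrow> 'x) \<Rightarrow> (('i \<Rightarrow> 'p) \<times> ('i \<Rightarrow> real)) set"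
  where "slope_constraints X' b I x =
    {(p, y). p \<in> I \<rightarrow>\<^sub>E X' \<and> y \<in> I \<rightarrow>\<^sub>E UNIV \<and>
       (\<forall>n\<in>I. \<forall>m\<in>I. ereal (y n - y m) \<ge> b (x n) (p m) -\<^sub>\<bottom> b (x m) (p m))}"

text \<open>
  The slope constraints alone admit indices \<open>m\<close> for which \<open>b (x n) (p m) = -\<infinity>\<close> for all \<open>n\<close>: as
  \<open>-\<infinity>\<close> is absorbing, every constraint involving \<open>p m\<close> is then void and \<open>y m\<close> is not tied to any
  function of the range.  A feasible parameter is therefore also required to have
  \<open>b (x m) (p m)\<close> finite.  By \<open>feasible_params_eq\<close> below, this changes nothing as soon as no
  \<open>b (\<cdot>, p)\<close> is identically \<open>-\<infinity>\<close> on the sample points.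
\<close>

definition feasible_params ::
    "'p set \<Rightarrow> ('x \<Rightarrow> 'p \<Rightarrow> ereal) \<Rightarrow> 'i set \<Rightarrow> ('i \<Rightarrow> 'x) \<Rightarrow> (('i \<Rightarrow> 'p) \<times> ('i \<Rightarrow> real)) set"
  where "feasible_params X' b I x =
    {(p, y) \<in> slope_constraints X' b I x. \<forall>m\<in>I. b (x m) (p m) \<noteq> -\<infinity>}"

definition solves_param_problem ::
    "'p set \<Rightarrow> ('x \<Rightarrow> 'p \<Rightarrow> ereal) \<Rightarrow> 'i set \<Rightarrow> ('i \<Rightarrow> 'x) \<Rightarrow>
     (('i \<Rightarrow> ereal) \<Rightarrow> ereal) \<Rightarrow> ('i \<Rightarrow> 'p) \<Rightarrow> ('i \<Rightarrow> real) \<Rightarrow> bool"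
  where "solves_param_problem X' b I x L p y \<longleftrightarrow>
    is_arg_min (\<lambda>(q, v). L (\<lambda>m\<in>I. ereal (v m)))
      (\<lambda>r. r \<in> feasible_params X' b I x) (p, y)"

text \<open>
  For infinite \<open>I\<close> the maximum defining this function need not be attained away from the sample
  points, whence the supremum.
\<close>

definition max_function ::
    "'x set \<Rightarrow> ('x \<Rightarrow> 'p \<Rightarrow> ereal) \<Rightarrow> 'i set \<Rightarrow> ('i \<Rightarrow> 'x) \<Rightarrow> ('i \<Rightarrow> 'p) \<Rightarrow> ('i \<Rightarrow> real) \<Rightarrow> 'x \<Rightarrow> ereal"
  where "max_function X b I x p y =
    (\<lambda>z\<in>X. SUP m\<in>I. (b z (p m) -\<^sub>\<bottom> b (x m) (p m)) + ereal (y m))"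

lemma feasible_params_eq:
  assumes b: "\<forall>m\<in>I. \<forall>p\<in>X'. b (x m) p \<noteq> \<infinity>"
    and proper: "\<forall>p\<in>X'. (\<exists>m\<in>I. b (x m) p = -\<infinity>) \<longrightarrow> (\<exists>n\<in>I. b (x n) p \<noteq> -\<infinity>)"
  shows "feasible_params X' b I x = slope_constraints X' b I x"
proof -
  have "b (x m) (p m) \<noteq> -\<infinity>" if py: "(p, y) \<in> slope_constraints X' b I x" and m: "m \<in> I" for p y m
  proof
    assume eq: "b (x m) (p m) = -\<infinity>"
    have pm: "p m \<in> X'"
      using py m by (auto simp: slope_constraints_def)
    then obtain n where n: "n \<in> I" "b (x n) (p m) \<noteq> -\<infinity>"
      using proper eq m by blast
    have "b (x n) (p m) -\<^sub>\<bottom> b (x m) (p m) = \<infinity>"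
      using n b pm eq by (auto simp: minus_bot_def plus_bot_def)
    moreover have "b (x n) (p m) -\<^sub>\<bottom> b (x m) (p m) \<le> ereal (y n - y m)"
      using py m n by (auto simp: slope_constraints_def)
    ultimately show False
      by simp
  qed
  then show ?thesis
    by (auto simp: feasible_params_def)
qed

end

theory Submission
  imports Defs
begin

text \<open>
  The transform \<^const>\<open>Bbar\<close> is one half of a Galois connection: the inequality
  \<open>b z p -\<^sub>\<bottom> c \<le> d\<close> is symmetric in \<open>c\<close> and \<open>d\<close> (lemma \<open>minus_bot_le_swap\<close>).  Hence
  \<open>b z q -\<^sub>\<bottom> Bbar X b f q \<le> f z\<close> for every \<open>f\<close>, and equality of \<open>f\<close> with the supremum of the left
  sides holds for every supremum of functions \<open>b (\<cdot>, p) -\<^sub>\<bottom> c\<close>.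

  The two problems are then related by maps that preserve the sample values and so the cost.
  A feasible \<open>(p, y)\<close> yields \<open>max_function X b I x p y\<close>, a supremum of functions
  \<open>b (\<cdot>, p m) -\<^sub>\<bottom> c m\<close> with \<open>c m = b (x m) (p m) - y m\<close>.  The slope constraints say exactly that,
  at \<open>x n\<close>, the piece with index \<open>n\<close> dominates all others; so this function takes the value
  \<open>y n\<close> there, and \<open>p n\<close> is a subgradient (\<open>max_function_in_Rg_subdiff\<close>).  Conversely,
  a function with subgradients at the sample points and finite values there satisfies the
  slope constraints with these subgradients and values (\<open>Rg_subdiff_feasible\<close>), because each
  piece \<open>b (\<cdot>, p m) -\<^sub>\<bottom> Bbar X b f (p m)\<close> lies below \<open>f\<close> and touches it at \<open>x m\<close>.
  Minimality therefore passes from one problem to the other.  The infimum over the whole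
  range may still be smaller, through functions without subgradients or with infinite samples,
  so passing to that problem requires one of its minimisers to have both subgradients and
  finite samples.
\<close>

section \<open>The Galois connection of the kernel\<close>

text \<open>
  For infinite arguments this rests on \<open>-\<infinity>\<close> being absorbing: both sides hold as soon as \<open>c\<close> or
  \<open>d\<close> is \<open>+\<infinity>\<close>, whatever \<open>a\<close> is.
\<close>

lemma minus_bot_le_swap: "a -\<^sub>\<bottom> c \<le> d \<longleftrightarrow> a -\<^sub>\<bottom> d \<le> c"
  by (cases a; cases c; cases d) (auto simp: minus_bot_def plus_bot_def algebra_simps)

lemma minus_bot_antimono: "c \<le> d \<Longrightarrow> a -\<^sub>\<bottom> d \<le> a -\<^sub>\<bottom> c"
  by (cases a; cases c; cases d) (auto simp: minus_bot_def plus_bot_def)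

lemma minus_bot_eq_realD:
  assumes "a -\<^sub>\<bottom> c = ereal r"
  obtains s t where "a = ereal s" "c = ereal t" "r = s - t"
  using assms
  by (cases a; cases c) (auto simp: minus_bot_def plus_bot_def)

lemma minus_bot_Bbar_le:
  assumes "z \<in> X"
  shows "b z p -\<^sub>\<bottom> Bbar X b f p \<le> f z"
proof -
  have "b z p -\<^sub>\<bottom> f z \<le> Bbar X b f p"
    unfolding Bbar_def using assms by (rule SUP_upper)
  then show ?thesis
    using minus_bot_le_swap by blast
qed

text \<open>
  The other half of the Galois connection: the transform at \<open>p\<close> is the least \<open>c\<close> for which
  \<open>b (\<cdot>, p) -\<^sub>\<bottom> c\<close> lies below \<open>f\<close>.
\<close>

lemma Bbar_le:
  assumes "\<And>z. z \<in> X \<Longrightarrow> b z p -\<^sub>\<bottom> c \<le> f z"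
  shows "Bbar X b f p \<le> c"
  unfolding Bbar_def
  by (rule SUP_least) (use assms minus_bot_le_swap in blast)

text \<open>
  The transform of \<open>f\<close> at \<open>p m\<close> is at most \<open>c m\<close>, so that replacing the constants by the
  transform raises every piece, and by \<open>minus_bot_Bbar_le\<close> none rises above \<open>f\<close>.
\<close>

lemma sup_of_pieces_eq_biconjugate:
  assumes p: "\<And>m. m \<in> I \<Longrightarrow> p m \<in> X'"
    and f: "\<And>z. z \<in> X \<Longrightarrow> f z = (SUP m\<in>I. b z (p m) -\<^sub>\<bottom> c m)"
    and z: "z \<in> X"
  shows "f z = (SUP q\<in>X'. b z q -\<^sub>\<bottom> Bbar X b f q)"
proof (rule antisym)
  have Bbar: "Bbar X b f (p m) \<le> c m" if m: "m \<in> I" for m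
  proof (rule Bbar_le)
    show "b u (p m) -\<^sub>\<bottom> c m \<le> f u" if "u \<in> X" for u
      unfolding f[OF that] using m by (rule SUP_upper)
  qed
  show "f z \<le> (SUP q\<in>X'. b z q -\<^sub>\<bottom> Bbar X b f q)"
    unfolding f[OF z]
    by (rule SUP_mono) (use p Bbar minus_bot_antimono in blast)
  show "(SUP q\<in>X'. b z q -\<^sub>\<bottom> Bbar X b f q) \<le> f z"
    by (rule SUP_least) (rule minus_bot_Bbar_le[of z X b _ f, OF z])
qed

section \<open>From feasible parameters to functions with subgradients\<close>

lemma feasible_paramsD:
  assumes "(p, y) \<in> feasible_params X' b I x"
  shows "\<And>m. m \<in> I \<Longrightarrow> p m \<in> X'"
    and "\<And>m. m \<in> I \<Longrightarrow> b (x m) (p m) \<noteq> -\<infinity>"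
    and "\<And>n m. n \<in> I \<Longrightarrow> m \<in> I \<Longrightarrow> b (x n) (p m) -\<^sub>\<bottom> b (x m) (p m) \<le> ereal (y n - y m)"
  using assms by (auto simp: feasible_params_def slope_constraints_def)

text \<open>
  As \<open>b (x m) (p m)\<close> is finite, the two real constants of a piece merge into one.
\<close>

lemma max_function_eq_sup_of_pieces:
  assumes kernel: "\<And>z p. z \<in> X \<Longrightarrow> p \<in> X' \<Longrightarrow> b z p \<noteq> \<infinity>"
    and points: "x \<in> I \<rightarrow> X"
    and feas: "(p, y) \<in> feasible_params X' b I x"
    and z: "z \<in> X"
  shows "max_function X b I x p y z = (SUP m\<in>I. b z (p m) -\<^sub>\<bottom> (b (x m) (p m) - ereal (y m)))"
proof -
  have "(b z (p m) -\<^sub>\<bottom> b (x m) (p m)) + ereal (y m) = b z (p m) -\<^sub>\<bottom> (b (x m) (p m) - ereal (y m))"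
    if m: "m \<in> I" for m
  proof -
    have "b (x m) (p m) \<noteq> \<infinity>" "b (x m) (p m) \<noteq> -\<infinity>"
      using kernel feasible_paramsD[OF feas] points m by blast+
    then show ?thesis
      by (cases "b (x m) (p m)"; cases "b z (p m)") (auto simp: minus_bot_def plus_bot_def)
  qed
  then show ?thesis
    unfolding max_function_def using z by (simp cong: SUP_cong)
qed

lemma max_function_at_sample:
  assumes kernel: "\<And>z p. z \<in> X \<Longrightarrow> p \<in> X' \<Longrightarrow> b z p \<noteq> \<infinity>"
    and points: "x \<in> I \<rightarrow> X"
    and feas: "(p, y) \<in> feasible_params X' b I x"
    and n: "n \<in> I"
  shows "max_function X b I x p y (x n) = ereal (y n)"
proof -
  have xn: "x n \<in> X"
    using points n by blast
  have "(SUP m\<in>I. (b (x n) (p m) -\<^sub>\<bottom> b (x m) (p m)) + ereal (y m)) = ereal (y n)"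
  proof (rule antisym)
    show "(SUP m\<in>I. (b (x n) (p m) -\<^sub>\<bottom> b (x m) (p m)) + ereal (y m)) \<le> ereal (y n)"
    proof (rule SUP_least)
      fix m assume "m \<in> I"
      from feasible_paramsD(3)[OF feas n this]
      show "(b (x n) (p m) -\<^sub>\<bottom> b (x m) (p m)) + ereal (y m) \<le> ereal (y n)"
        by (cases "b (x n) (p m) -\<^sub>\<bottom> b (x m) (p m)") auto
    qed
    have "b (x n) (p n) \<noteq> \<infinity>" "b (x n) (p n) \<noteq> -\<infinity>"
      using kernel feasible_paramsD[OF feas] xn n by blast+
    then have "(b (x n) (p n) -\<^sub>\<bottom> b (x n) (p n)) + ereal (y n) = ereal (y n)"
      by (cases "b (x n) (p n)") (auto simp: minus_bot_def plus_bot_def)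
    then show "ereal (y n) \<le> (SUP m\<in>I. (b (x n) (p m) -\<^sub>\<bottom> b (x m) (p m)) + ereal (y m))"
      using SUP_upper[OF n, of "\<lambda>m. (b (x n) (p m) -\<^sub>\<bottom> b (x m) (p m)) + ereal (y m)"] by simp
  qed
  then show ?thesis
    using xn by (simp add: max_function_def)
qed

text \<open>
  At \<open>x n\<close> the subgradient is \<open>p n\<close>: the piece with index \<open>n\<close> attains the value there, and
  replacing its constant by the transform at \<open>p n\<close>, which is at most this constant, only
  raises the piece, though never above the function.
\<close>

lemma max_function_in_Rg_subdiff:
  assumes kernel: "\<And>z p. z \<in> X \<Longrightarrow> p \<in> X' \<Longrightarrow> b z p \<noteq> \<infinity>"
    and points: "x \<in> I \<rightarrow> X"
    and feas: "(p, y) \<in> feasible_params X' b I x"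
  shows "max_function X b I x p y \<in> Rg_subdiff X X' b (x ` I)"
proof -
  define f where "f = max_function X b I x p y"
  define c where "c m = b (x m) (p m) - ereal (y m)" for m
  have p: "p m \<in> X'" if "m \<in> I" for m
    using feasible_paramsD[OF feas] that by blast
  have pieces: "f z = (SUP m\<in>I. b z (p m) -\<^sub>\<bottom> c m)" if "z \<in> X" for z
    unfolding f_def c_def
    using max_function_eq_sup_of_pieces[OF kernel points feas that] .
  have biconj: "f z = (SUP q\<in>X'. b z q -\<^sub>\<bottom> Bbar X b f q)" if "z \<in> X" for z
    using sup_of_pieces_eq_biconjugate[OF p pieces that] .
  have "f \<in> Rg X X' b"
    unfolding Rg_def using biconj by (auto simp: f_def max_function_def)
  moreover have "f (x n) = b (x n) (p n) -\<^sub>\<bottom> Bbar X b f (p n)" if n: "n \<in> I" for n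
  proof (rule antisym)
    have xn: "x n \<in> X"
      using points n by blast
    show "b (x n) (p n) -\<^sub>\<bottom> Bbar X b f (p n) \<le> f (x n)"
      using xn by (rule minus_bot_Bbar_le)
    have "b (x n) (p n) \<noteq> \<infinity>" "b (x n) (p n) \<noteq> -\<infinity>"
      using kernel feasible_paramsD[OF feas] xn n by blast+
    then have "f (x n) = b (x n) (p n) -\<^sub>\<bottom> c n"
      using max_function_at_sample[OF kernel points feas n]
      by (cases "b (x n) (p n)") (auto simp: f_def c_def minus_bot_def plus_bot_def)
    moreover have "Bbar X b f (p n) \<le> c n"
    proof (rule Bbar_le)
      show "b u (p n) -\<^sub>\<bottom> c n \<le> f u" if "u \<in> X" for u
        unfolding pieces[OF that] using n by (rule SUP_upper)
    qed
    ultimately show "f (x n) \<le> b (x n) (p n) -\<^sub>\<bottom> Bbar X b f (p n)"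
      using minus_bot_antimono by metis
  qed
  ultimately have "f \<in> Rg_subdiff X X' b (x ` I)"
    unfolding Rg_subdiff_def using p biconj points by blast
  then show ?thesis
    by (simp add: f_def)
qed

section \<open>From functions with subgradients to feasible parameters\<close>

text \<open>
  Subtracting the equality \<open>f (x m) = b (x m) (p m) - Bbar X b f (p m)\<close> from the inequality
  \<open>f (x n) \<ge> b (x n) (p m) - Bbar X b f (p m)\<close> gives the slope constraint.  Finiteness of
  \<open>f (x m)\<close> makes both terms on the right of the equality real, so that this is legitimate.
\<close>

lemma Rg_subdiff_feasible:
  assumes points: "x \<in> I \<rightarrow> X"
    and f: "f \<in> Rg_subdiff X X' b (x ` I)"
    and fin: "finite_on_samples I x f"
  obtains p y where "(p, y) \<in> feasible_params X' b I x"
    and "samples I x f = (\<lambda>m\<in>I. ereal (y m))"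
proof -
  have "\<forall>m\<in>I. \<exists>p\<in>X'. f (x m) = b (x m) p -\<^sub>\<bottom> Bbar X b f p"
    using f unfolding Rg_subdiff_def by blast
  then obtain p0 where p0: "\<forall>m\<in>I. p0 m \<in> X' \<and> f (x m) = b (x m) (p0 m) -\<^sub>\<bottom> Bbar X b f (p0 m)"
    by metis
  define p where "p = restrict p0 I"
  define y where "y = (\<lambda>m\<in>I. real_of_ereal (f (x m)))"
  have p: "p m \<in> X'" and touch: "f (x m) = b (x m) (p m) -\<^sub>\<bottom> Bbar X b f (p m)"
    and y: "f (x m) = ereal (y m)" if "m \<in> I" for m
    using p0 fin that by (auto simp: p_def y_def finite_on_samples_def ereal_real)
  have constraint: "b (x n) (p m) -\<^sub>\<bottom> b (x m) (p m) \<le> ereal (y n - y m) \<and> b (x m) (p m) \<noteq> -\<infinity>"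
    if n: "n \<in> I" and m: "m \<in> I" for n m
  proof -
    have xn: "x n \<in> X"
      using points n by blast
    have "b (x m) (p m) -\<^sub>\<bottom> Bbar X b f (p m) = ereal (y m)"
      using touch[OF m] y[OF m] by simp
    then obtain s t where st: "b (x m) (p m) = ereal s" "Bbar X b f (p m) = ereal t" "y m = s - t"
      by (rule minus_bot_eq_realD)
    have "b (x n) (p m) -\<^sub>\<bottom> ereal t \<le> ereal (y n)"
      using minus_bot_Bbar_le[OF xn, of b "p m" f] st(2) y[OF n] by simp
    then show ?thesis
      using st by (cases "b (x n) (p m)") (auto simp: minus_bot_def plus_bot_def)
  qed
  show thesis
  proof
    show "(p, y) \<in> feasible_params X' b I x"
      using p constraint
      by (auto simp: feasible_params_def slope_constraints_def p_def y_def)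
    show "samples I x f = (\<lambda>m\<in>I. ereal (y m))"
      unfolding samples_def using y by (auto simp: restrict_def)
  qed
qed

section \<open>Equivalence of the minimisation problems\<close>

theorem corollary7p2:
  fixes X :: "'x set" and X' :: "'p set" and b :: "'x \<Rightarrow> 'p \<Rightarrow> ereal"
    and I :: "'i set" and x :: "'i \<Rightarrow> 'x" and L :: "('i \<Rightarrow> ereal) \<Rightarrow> ereal"
  assumes kernel: "\<And>z p. z \<in> X \<Longrightarrow> p \<in> X' \<Longrightarrow> b z p \<noteq> \<infinity>"
    and points: "x \<in> I \<rightarrow> X"
  shows
    "((\<exists>f. solves_range_problem X X' b I x L f \<and>
           f \<in> Rg_subdiff X X' b (x ` I) \<and> finite_on_samples I x f) \<longrightarrow>
      (\<exists>p y. solves_param_problem X' b I x L p y \<and>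
         (\<forall>m\<in>I. max_function X b I x p y (x m) = ereal (y m)) \<and>
         solves_range_problem X X' b I x L (max_function X b I x p y)))
     \<and>
     (\<forall>p y. solves_param_problem X' b I x L p y \<longrightarrow>
        max_function X b I x p y \<in> Rg_subdiff X X' b (x ` I) \<and>
        (\<forall>m\<in>I. max_function X b I x p y (x m) = ereal (y m)) \<and>
        is_arg_min (\<lambda>g. L (samples I x g))
          (\<lambda>g. g \<in> Rg_subdiff X X' b (x ` I) \<and> finite_on_samples I x g)
          (max_function X b I x p y) \<and>
        ((\<exists>f. solves_range_problem X X' b I x L f \<and>
              f \<in> Rg_subdiff X X' b (x ` I) \<and> finite_on_samples I x f) \<longrightarrow>
         solves_range_problem X X' b I x L (max_function X b I x p y)))"
proof -
  let ?F = "max_function X b I x"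
  let ?good = "\<lambda>g. g \<in> Rg_subdiff X X' b (x ` I) \<and> finite_on_samples I x g"
  have val: "\<forall>m\<in>I. ?F p y (x m) = ereal (y m)"
    and subdiff: "?F p y \<in> Rg_subdiff X X' b (x ` I)"
    if "(p, y) \<in> feasible_params X' b I x" for p y
    using max_function_at_sample[OF kernel points that]
      max_function_in_Rg_subdiff[OF kernel points that] by blast+
  have samp: "samples I x (?F p y) = (\<lambda>m\<in>I. ereal (y m))" and good: "?good (?F p y)"
    if "(p, y) \<in> feasible_params X' b I x" for p y
    using val[OF that] subdiff[OF that]
    by (auto simp: samples_def finite_on_samples_def restrict_def)
  have Rg: "g \<in> Rg X X' b" if "g \<in> Rg_subdiff X X' b (x ` I)" for g
    using that by (simp add: Rg_subdiff_def)
  have param: "(p, y) \<in> feasible_params X' b I x"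
    "\<And>q v. (q, v) \<in> feasible_params X' b I x \<Longrightarrow>
       \<not> L (\<lambda>m\<in>I. ereal (v m)) < L (\<lambda>m\<in>I. ereal (y m))"
    if "solves_param_problem X' b I x L p y" for p y
    using that by (auto simp: solves_param_problem_def is_arg_min_def)
  \<comment> \<open>Every competitor with subgradients and finite samples costs as much as some feasible parameter.\<close>
  have le: "\<not> L (samples I x g) < L (\<lambda>m\<in>I. ereal (y m))"
    if sol: "solves_param_problem X' b I x L p y" and g: "?good g" for p y g
  proof -
    obtain q v where "(q, v) \<in> feasible_params X' b I x" "samples I x g = (\<lambda>m\<in>I. ereal (v m))"
      by (rule Rg_subdiff_feasible[OF points conjunct1[OF g] conjunct2[OF g]])
    then show ?thesis
      using param(2)[OF sol] by simp
  qed
  have to_range: "solves_range_problem X X' b I x L (?F p y)"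
    if sol: "solves_param_problem X' b I x L p y"
      and f: "solves_range_problem X X' b I x L f" "?good f" for p y f
  proof -
    note feas = param(1)[OF sol]
    have "\<not> L (samples I x g) < L (\<lambda>m\<in>I. ereal (y m))" if "g \<in> Rg X X' b" for g
    proof -
      have "\<not> L (samples I x g) < L (samples I x f)"
        using f(1) that by (simp add: solves_range_problem_def is_arg_min_def)
      then show ?thesis
        using le[OF sol f(2)] by simp
    qed
    then show ?thesis
      using Rg[OF subdiff[OF feas]] samp[OF feas]
      by (auto simp: solves_range_problem_def is_arg_min_def)
  qed
  have from_range: "\<exists>p y. solves_param_problem X' b I x L p y"
    if f: "solves_range_problem X X' b I x L f" "?good f" for f
  proof -
    obtain p y where py: "(p, y) \<in> feasible_params X' b I x"
        "samples I x f = (\<lambda>m\<in>I. ereal (y m))"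
      by (rule Rg_subdiff_feasible[OF points conjunct1[OF f(2)] conjunct2[OF f(2)]])
    have "\<not> L (\<lambda>m\<in>I. ereal (v m)) < L (\<lambda>m\<in>I. ereal (y m))"
      if "(q, v) \<in> feasible_params X' b I x" for q v
    proof -
      have "\<not> L (samples I x (?F q v)) < L (samples I x f)"
        using f(1) Rg[OF subdiff[OF that]] by (simp add: solves_range_problem_def is_arg_min_def)
      then show ?thesis
        by (simp add: samp[OF that] py(2))
    qed
    then show ?thesis
      using py(1) by (auto simp: solves_param_problem_def is_arg_min_def)
  qed
  have arg_min: "is_arg_min (\<lambda>g. L (samples I x g)) ?good (?F p y)"
    if sol: "solves_param_problem X' b I x L p y" for p y
    unfolding is_arg_min_def samp[OF param(1)[OF sol]]
    using le[OF sol] good[OF param(1)[OF sol]] by blast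
  show ?thesis
  proof (intro conjI impI allI)
    assume "\<exists>f. solves_range_problem X X' b I x L f \<and> ?good f"
    then obtain f where f: "solves_range_problem X X' b I x L f" "?good f"
      by blast
    then obtain p y where sol: "solves_param_problem X' b I x L p y"
      using from_range by blast
    show "\<exists>p y. solves_param_problem X' b I x L p y \<and>
        (\<forall>m\<in>I. ?F p y (x m) = ereal (y m)) \<and> solves_range_problem X X' b I x L (?F p y)"
      using sol val[OF param(1)[OF sol]] to_range[OF sol f] by blast
  next
    fix p y assume sol: "solves_param_problem X' b I x L p y"
    show "?F p y \<in> Rg_subdiff X X' b (x ` I)"
      using subdiff[OF param(1)[OF sol]] .
    show "\<forall>m\<in>I. ?F p y (x m) = ereal (y m)"
      using val[OF param(1)[OF sol]] .
    show "is_arg_min (\<lambda>g. L (samples I x g)) ?good (?F p y)"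
      using arg_min[OF sol] .
    assume "\<exists>f. solves_range_problem X X' b I x L f \<and> ?good f"
    then show "solves_range_problem X X' b I x L (?F p y)"
      using to_range[OF sol] by blast
  qed
qed

end
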